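(* Let $k\ge1$ be an integer, $r$ any integer and $m$ an odd integer. Then \begin{align*} &\sum_{n=1}^\infty\frac{\lfloor n/k\rfloor}{\sqrt{5^n}\,F_m^{n+1}}\Big(\frac{\sqrt5\,L_{mn+r}F_m}{n}-\frac{L_{m(n+1)+r}}{n+1}\Big)\\ &\quad=-\frac{\sqrt5\,\alpha^r}{k}\log\big(5^kF_m^{2k}-\sqrt{5^k}F_m^kL_{mk}+(-1)^k\big)+\frac{5F_r}{k}\log\big(\sqrt{5^k}F_m^k-\beta^{mk}\big)+\sqrt5\,L_r\log(\sqrt5F_m), \end{align*} and \begin{align*} &\sum_{n=1}^\infty\frac{\lfloor n/k\rfloor}{\sqrt{5^n}\,F_m^{n+1}}\Big(\frac{\sqrt5\,F_{mn+r}F_m}{n}-\frac{F_{m(n+1)+r}}{n+1}\Big)\\ &\quad=-\frac{\alpha^r}{k}\log\big(5^kF_m^{2k}-\sqrt{5^k}F_m^kL_{mk}+(-1)^k\big)+\frac{L_r}{k}\log\big(\sqrt{5^k}F_m^k-\beta^{mk}\big)+\sqrt5\,F_r\log(\sqrt5F_m). \end{align*}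
   Context: $\alpha=(1+\sqrt5)/2$, $\beta=(1-\sqrt5)/2$; $F_n=(\alpha^n-\beta^n)/\sqrt5$ and $L_n=\alpha^n+\beta^n$ are the Fibonacci and Lucas numbers for all integers $n$. $\lfloor x\rfloor$ is the floor function and $\log$ the natural logarithm. *)

theory Defs
  imports "HOL-Analysis.Analysis" "HOL-Number_Theory.Fib"
begin

definition alpha :: real where
  "alpha = (1 + sqrt 5) / 2"

definition beta :: real where
  "beta = (1 - sqrt 5) / 2"

text \<open>Fibonacci and Lucas numbers for arbitrary integer indices, as real numbers given by the
  Binet formulas.\<close>

definition fibz :: "int \<Rightarrow> real" where
  "fibz n = (alpha powi n - beta powi n) / sqrt 5"

definition lucasz :: "int \<Rightarrow> real" where
  "lucasz n = alpha powi n + beta powi n"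

lemma fibz_int: "fibz (int n) = real (fib n)"
  using fib_closed_form[of n] by (simp add: fibz_def alpha_def beta_def)

end

theory Submission
  imports Defs
begin

text \<open>
  Put \<open>A = \<surd>5 F\<^sub>m = \<alpha>\<^sup>m - \<beta>\<^sup>m\<close>. For odd \<open>m\<close> we have \<open>\<alpha>\<^sup>m > 0 > \<beta>\<^sup>m\<close>, so \<open>x = \<alpha>\<^sup>m / A\<close> and
  \<open>y = \<beta>\<^sup>m / A\<close> lie in \<open>(-1, 1)\<close>, and the \<open>n\<close>-th summand is \<open>\<lfloor>n/k\<rfloor> (u\<^sub>n - u\<^sub>n\<^sub>+\<^sub>1)\<close>, where \<open>u\<^sub>n\<close> is a
  linear combination of \<open>x\<^sup>n / n\<close> and \<open>y\<^sup>n / n\<close>. As \<open>\<lfloor>n/k\<rfloor>\<close> jumps by one exactly at the multiples of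
  \<open>k\<close>, Abel summation turns the series into the sum of the \<open>u\<^sub>j\<^sub>k\<close>, a combination of
  \<open>ln (1 - x\<^sup>k)\<close> and \<open>ln (1 - y\<^sup>k)\<close>. The argument of the first logarithm on the right-hand side
  factors as \<open>(A\<^sup>k - \<alpha>\<^sup>m\<^sup>k) (A\<^sup>k - \<beta>\<^sup>m\<^sup>k)\<close>, and the multiples of \<open>ln A\<close> cancel.
\<close>

text \<open>Finite Abel summation with explicit boundary term. In the induction step the quotient
  grows only if \<open>k\<close> divides \<open>Suc N\<close>; the new summand on the right is then
  \<open>u (Suc N)\<close> itself.\<close>

lemma sum_div_mult_diff:
  fixes u :: "nat \<Rightarrow> 'a::comm_ring_1"
  assumes "k \<ge> 1"
  shows "(\<Sum>i<N. of_nat (Suc i div k) * (u (Suc i) - u (Suc (Suc i)))) =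
           (\<Sum>j<N div k. u (Suc j * k)) - of_nat (N div k) * u (Suc N)"
proof (induction N)
  case 0
  show ?case by simp
next
  case (Suc N)
  show ?case
  proof (cases "Suc N mod k = 0")
    case True
    then have "Suc N div k = Suc (N div k)" by (simp add: div_Suc)
    moreover from this True have "Suc (N div k) * k = Suc N"
      by (metis div_mod_decomp add_0_right)
    ultimately show ?thesis using Suc by (simp add: algebra_simps)
  next
    case False
    then have "Suc N div k = N div k" by (simp add: div_Suc)
    then show ?thesis using Suc by (simp add: algebra_simps)
  qed
qed

lemma ln_one_minus_sums:
  fixes z :: real
  assumes "\<bar>z\<bar> < 1"
  shows "(\<lambda>j. z ^ Suc j / real (Suc j)) sums (- ln (1 - z))"
proof -
  have "(\<lambda>n. - (- ((- (- z)) ^ n) / real n)) sums (- ln (1 + - z))"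
    using assms by (intro sums_minus ln_series') simp
  \<comment> \<open>The term at index 0 is a division by zero, hence 0, so the index shift leaves
    the sum unchanged.\<close>
  then show ?thesis
    by (subst sums_Suc_iff) simp
qed

text \<open>With \<open>u n = z ^ n / n\<close>, Abel summation leaves the terms
  \<open>u (j * k) = (z ^ k) ^ j / (j * k)\<close>, which form the logarithm series at
  \<open>z ^ k\<close> divided by \<open>k\<close>.\<close>

lemma div_power_diff_sums:
  fixes z :: real
  assumes k: "k \<ge> 1" and z: "\<bar>z\<bar> < 1"
  shows "(\<lambda>i. real (Suc i div k) * (z ^ Suc i / real (Suc i) - z ^ Suc (Suc i) / real (Suc (Suc i))))
           sums (- ln (1 - z ^ k) / real k)"
proof -
  define u where "u n = z ^ n / real n" for n
  have "\<bar>z ^ k\<bar> < 1"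
    using k z by (simp add: power_abs power_less_one_iff)
  from sums_divide[OF ln_one_minus_sums[OF this], of "real k"]
  have "(\<lambda>j. (z ^ k) ^ Suc j / real (Suc j) / real k) sums (- ln (1 - z ^ k) / real k)" .
  moreover have "(z ^ k) ^ Suc j / real (Suc j) / real k = u (Suc j * k)" for j
    unfolding u_def by (simp only: mult.commute[of "Suc j"] power_mult) (simp add: algebra_simps)
  ultimately have "(\<lambda>j. u (Suc j * k)) sums (- ln (1 - z ^ k) / real k)"
    by simp
  then have "(\<lambda>N. \<Sum>j<N. u (Suc j * k)) \<longlonglongrightarrow> - ln (1 - z ^ k) / real k"
    by (simp add: sums_def)
  \<comment> \<open>The partial sums stop at \<open>N div k\<close> instead of \<open>N\<close>;
    this index also tends to infinity, so the limit is the same.\<close>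
  moreover have "filterlim (\<lambda>N. N div k) at_top sequentially"
    unfolding filterlim_at_top
  proof
    fix c
    show "eventually (\<lambda>N. c \<le> N div k) sequentially"
      using eventually_ge_at_top[of "c * k"]
      by eventually_elim (use k in \<open>simp add: less_eq_div_iff_mult_less_eq\<close>)
  qed
  ultimately have main: "(\<lambda>N. \<Sum>j<N div k. u (Suc j * k)) \<longlonglongrightarrow> - ln (1 - z ^ k) / real k"
    by (rule filterlim_compose)
  \<comment> \<open>The boundary term vanishes: the factor \<open>N div k\<close> is absorbed by the
    denominator of \<open>u (Suc N)\<close>, and a geometric bound remains.\<close>
  have "(\<lambda>N. real (N div k) * u (Suc N)) \<longlonglongrightarrow> 0"
  proof (rule Lim_null_comparison)
    show "eventually (\<lambda>N. norm (real (N div k) * u (Suc N)) \<le> \<bar>z\<bar> ^ Suc N) sequentially"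
    proof (intro always_eventually allI)
      fix N
      have "N div k \<le> Suc N" using div_le_dividend[of N k] by linarith
      then have "real (N div k) / real (Suc N) \<le> 1" by simp
      then have "real (N div k) / real (Suc N) * \<bar>z\<bar> ^ Suc N \<le> 1 * \<bar>z\<bar> ^ Suc N"
        by (intro mult_right_mono) auto
      then show "norm (real (N div k) * u (Suc N)) \<le> \<bar>z\<bar> ^ Suc N"
        by (simp add: u_def abs_mult power_abs del: power_Suc of_nat_Suc)
    qed
    show "(\<lambda>N. \<bar>z\<bar> ^ Suc N) \<longlonglongrightarrow> 0"
      using z by (intro LIMSEQ_Suc LIMSEQ_power_zero) simp
  qed
  from tendsto_diff[OF main this]
  have "(\<lambda>i. real (Suc i div k) * (u (Suc i) - u (Suc (Suc i)))) sums (- ln (1 - z ^ k) / real k)"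
    unfolding sums_def sum_div_mult_diff[OF k] by simp
  then show ?thesis
    by (simp only: u_def)
qed

lemma alpha_pos: "alpha > 0"
  by (simp add: alpha_def add_pos_pos)

lemma beta_neg: "beta < 0"
  by (simp add: beta_def)

lemma alpha_mult_beta: "alpha * beta = - 1"
  by (simp add: alpha_def beta_def algebra_simps)

lemma sqrt5_fibz: "sqrt 5 * fibz n = alpha powi n - beta powi n"
  by (simp add: fibz_def)

theorem theorem9:
  fixes k :: nat and r m :: int
  assumes "k \<ge> 1" and "odd m"
  shows
    "((\<lambda>i. let n = Suc i in
        real_of_int \<lfloor>real n / real k\<rfloor> / (sqrt (5 ^ n) * fibz m ^ (n + 1)) *
        (sqrt 5 * lucasz (m * int n + r) * fibz m / real n
          - lucasz (m * (int n + 1) + r) / real (n + 1)))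
      sums
       (- (sqrt 5 * alpha powi r / real k) *
            ln (5 ^ k * fibz m ^ (2 * k) - sqrt (5 ^ k) * fibz m ^ k * lucasz (m * int k) + (- 1) ^ k)
        + 5 * fibz r / real k * ln (sqrt (5 ^ k) * fibz m ^ k - beta powi (m * int k))
        + sqrt 5 * lucasz r * ln (sqrt 5 * fibz m)))
     \<and>
     ((\<lambda>i. let n = Suc i in
        real_of_int \<lfloor>real n / real k\<rfloor> / (sqrt (5 ^ n) * fibz m ^ (n + 1)) *
        (sqrt 5 * fibz (m * int n + r) * fibz m / real n
          - fibz (m * (int n + 1) + r) / real (n + 1)))
      sums
       (- (alpha powi r / real k) *
            ln (5 ^ k * fibz m ^ (2 * k) - sqrt (5 ^ k) * fibz m ^ k * lucasz (m * int k) + (- 1) ^ k)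
        + lucasz r / real k * ln (sqrt (5 ^ k) * fibz m ^ k - beta powi (m * int k))
        + sqrt 5 * fibz r * ln (sqrt 5 * fibz m)))"
proof -
  define a where "a = alpha powi m"
  define b where "b = beta powi m"
  define A where "A = sqrt 5 * fibz m"
  define P where "P = alpha powi r"
  define Q where "Q = beta powi r"
  have A: "A = a - b" by (simp add: A_def a_def b_def sqrt5_fibz)
  have a: "a > 0" using alpha_pos by (simp add: a_def zero_less_power_int)
  have ab: "a * b = - 1"
    using \<open>odd m\<close> by (simp add: a_def b_def alpha_mult_beta flip: power_int_mult_distrib)
  then have b: "b < 0" using a mult_less_0_iff[of a b] by simp
  have A0: "A > 0" using A a b by simp
  have F: "fibz m = A / sqrt 5" by (simp add: A_def)
  have sqrt5: "sqrt 5 * sqrt 5 = 5" by simp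
  have ne: "alpha \<noteq> 0" "beta \<noteq> 0" using alpha_pos beta_neg by auto
  have pa: "alpha powi (m * int n + r) = P * a ^ n" for n
    using ne by (simp add: power_int_add power_int_mult P_def a_def)
  have pb: "beta powi (m * int n + r) = Q * b ^ n" for n
    using ne by (simp add: power_int_add power_int_mult Q_def b_def)
  have Lmn: "lucasz (m * int n + r) = P * a ^ n + Q * b ^ n" for n
    by (simp add: lucasz_def pa pb)
  have Fmn: "fibz (m * int n + r) = (P * a ^ n - Q * b ^ n) / sqrt 5" for n
    by (simp add: fibz_def pa pb)
  have SA: "sqrt (5 ^ n) * fibz m ^ n = A ^ n" for n
    by (simp add: A_def power_mult_distrib real_sqrt_power)
  have denom: "sqrt (5 ^ n) * fibz m ^ (n + 1) = A ^ Suc n / sqrt 5" for n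
    using SA[of n] by (simp add: F field_simps)

  define x where "x = a / A"
  define y where "y = b / A"
  \<comment> \<open>Both bounds follow from \<open>x - y = 1\<close> and
    \<open>x > 0 > y\<close>.\<close>
  have x1: "\<bar>x\<bar> < 1" and y1: "\<bar>y\<bar> < 1"
    using A a b by (auto simp: x_def y_def abs_if field_simps)
  define w where "w z i = real (Suc i div k) *
    (z ^ Suc i / real (Suc i) - z ^ Suc (Suc i) / real (Suc (Suc i)))" for z :: real and i
  have W: "(\<lambda>i. c * w x i + d * w y i) sums
      (c * (- ln (1 - x ^ k) / real k) + d * (- ln (1 - y ^ k) / real k))" for c d
    unfolding w_def
    by (intro sums_add sums_mult div_power_diff_sums \<open>k \<ge> 1\<close> x1 y1)

  \<comment> \<open>General \<open>c\<close> and \<open>d\<close> serve both series: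
    \<open>P\<close>, \<open>Q\<close> for Lucas numbers, and \<open>P / sqrt 5\<close>,
    \<open>- Q / sqrt 5\<close> for Fibonacci numbers.\<close>
  have term_eq: "real (Suc i div k) / (A ^ Suc (Suc i) / sqrt 5) *
      ((c * a ^ Suc i + d * b ^ Suc i) * A / real (Suc i)
        - (c * a ^ Suc (Suc i) + d * b ^ Suc (Suc i)) / real (Suc (Suc i))) =
      sqrt 5 * c * w x i + sqrt 5 * d * w y i" for c d i
  proof -
    define p where "p = real (Suc i)"
    define q where "q = real (Suc (Suc i))"
    have "p \<noteq> 0" "q \<noteq> 0" by (simp_all add: p_def q_def del: of_nat_Suc)
    then show ?thesis
      using A0 unfolding w_def x_def y_def power_divide p_def[symmetric] q_def[symmetric]
      by (simp add: divide_simps) (simp add: algebra_simps)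
  qed

  have "\<bar>x ^ k\<bar> < 1" "\<bar>y ^ k\<bar> < 1"
    using x1 y1 \<open>k \<ge> 1\<close> by (simp_all add: power_abs power_less_one_iff)
  \<comment> \<open>Positivity of both factors is what allows the logarithms of the products below
    to be split.\<close>
  then have xk: "1 - x ^ k > 0" and yk: "1 - y ^ k > 0" by linarith+
  have Ax: "A ^ k * (1 - x ^ k) = A ^ k - a ^ k" and Ay: "A ^ k * (1 - y ^ k) = A ^ k - b ^ k"
    using A0 by (simp_all add: x_def y_def power_divide field_simps)
  have bk: "beta powi (m * int k) = b ^ k"
    by (simp add: b_def power_int_mult)
  have "A * A = 5 * (fibz m)\<^sup>2"
    by (simp add: A_def power2_eq_square)
  then have "5 ^ k * fibz m ^ (2 * k) = A ^ k * A ^ k"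
    by (metis power_mult power_mult_distrib)
  moreover have "lucasz (m * int k) = a ^ k + b ^ k"
    by (simp add: lucasz_def a_def b_def power_int_mult)
  moreover have "(- 1) ^ k = a ^ k * b ^ k"
    by (simp add: ab flip: power_mult_distrib)
  ultimately have "5 ^ k * fibz m ^ (2 * k) - sqrt (5 ^ k) * fibz m ^ k * lucasz (m * int k) + (- 1) ^ k
      = (A ^ k * (1 - x ^ k)) * (A ^ k * (1 - y ^ k))"
    unfolding Ax Ay SA by (simp add: algebra_simps)
  then have ln1: "ln (5 ^ k * fibz m ^ (2 * k) - sqrt (5 ^ k) * fibz m ^ k * lucasz (m * int k) + (- 1) ^ k)
      = 2 * real k * ln A + ln (1 - x ^ k) + ln (1 - y ^ k)"
    using A0 xk yk by (simp add: ln_mult ln_realpow)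
  have ln2: "ln (sqrt (5 ^ k) * fibz m ^ k - beta powi (m * int k)) = real k * ln A + ln (1 - y ^ k)"
    unfolding SA bk Ay[symmetric] using A0 yk by (simp add: ln_mult ln_realpow)
  have floor_eq: "real_of_int \<lfloor>real n / real k\<rfloor> = real (n div k)" for n
    by (simp add: floor_divide_of_nat_eq)
  have index_eq: "m * (int n + 1) + r = m * int (Suc n) + r" for n
    by (simp add: algebra_simps)
  have k0: "real k \<noteq> 0" using \<open>k \<ge> 1\<close> by simp

  show ?thesis
  proof (rule conjI, goal_cases)
    case 1
    have "real (Suc i div k) / (A ^ Suc (Suc i) / sqrt 5) *
        (sqrt 5 * (P * a ^ Suc i + Q * b ^ Suc i) * fibz m / real (Suc i)
          - (P * a ^ Suc (Suc i) + Q * b ^ Suc (Suc i)) / real (Suc (Suc i)))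
        = sqrt 5 * P * w x i + sqrt 5 * Q * w y i" for i
      unfolding term_eq[symmetric] A_def by (simp only: mult_ac)
    \<comment> \<open>Compare coefficients: \<open>ln (1 - y ^ k)\<close> gets
      \<open>- P + (P - Q) = - Q\<close> times \<open>sqrt 5 / k\<close>, and \<open>ln A\<close>
      gets \<open>- 2 * P + (P - Q) + (P + Q) = 0\<close> times \<open>sqrt 5\<close>.\<close>
    moreover have "sqrt 5 * P * (- ln (1 - x ^ k) / real k) + sqrt 5 * Q * (- ln (1 - y ^ k) / real k)
        = - (sqrt 5 * P / real k) * (2 * real k * ln A + ln (1 - x ^ k) + ln (1 - y ^ k))
          + 5 * fibz r / real k * (real k * ln A + ln (1 - y ^ k)) + sqrt 5 * lucasz r * ln A"
    proof -
      have F5: "5 * fibz r = sqrt 5 * (P - Q)"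
        using sqrt5_fibz[of r] sqrt5 by (metis P_def Q_def mult.assoc)
      have L: "lucasz r = P + Q" by (simp add: lucasz_def P_def Q_def)
      show ?thesis
        unfolding F5 L using k0 by (simp add: field_simps)
    qed
    ultimately show ?case
      using W[of "sqrt 5 * P" "sqrt 5 * Q"]
      unfolding Let_def ln1 ln2 floor_eq index_eq denom Lmn
      by (simp only: Suc_eq_plus1[symmetric] P_def[symmetric] A_def[symmetric])
  next
    case 2
    have "real (Suc i div k) / (A ^ Suc (Suc i) / sqrt 5) *
        (sqrt 5 * ((P * a ^ Suc i - Q * b ^ Suc i) / sqrt 5) * fibz m / real (Suc i)
          - (P * a ^ Suc (Suc i) - Q * b ^ Suc (Suc i)) / sqrt 5 / real (Suc (Suc i)))
        = P * w x i + (- Q) * w y i" for i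
      using term_eq[of i "P / sqrt 5" "- Q / sqrt 5"] unfolding F
      by (simp add: diff_divide_distrib)
    \<comment> \<open>Here \<open>lucasz r = P + Q\<close> and
      \<open>sqrt 5 * fibz r = P - Q\<close> exchange roles, so \<open>ln (1 - y ^ k)\<close> gets
      \<open>Q / k\<close> and \<open>ln A\<close> again cancels.\<close>
    moreover have "P * (- ln (1 - x ^ k) / real k) + (- Q) * (- ln (1 - y ^ k) / real k)
        = - (P / real k) * (2 * real k * ln A + ln (1 - x ^ k) + ln (1 - y ^ k))
          + lucasz r / real k * (real k * ln A + ln (1 - y ^ k)) + sqrt 5 * fibz r * ln A"
      unfolding sqrt5_fibz lucasz_def P_def[symmetric] Q_def[symmetric]
      using k0 by (simp add: field_simps)
    ultimately show ?case
      using W[of P "- Q"]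
      unfolding Let_def ln1 ln2 floor_eq index_eq denom Fmn
      by (simp only: Suc_eq_plus1[symmetric] P_def[symmetric] A_def[symmetric])
  qed
qed

end
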